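(* Let $d\ge2$. Let $\widehat V:\mathbf Z^d\to\mathbf R$ be such that there exists $R_0>0$ with $\widehat V(n)=0$ for all $|n|>R_0$, and let $\widehat H=-\Delta_{disc}+\widehat V$ on $\ell^2(\mathbf Z^d)$. Then $\sigma_p(\widehat H)\cap(0,d)=\emptyset$.
   Context: $\mathbf Z^d$ is the square lattice with standard basis $e_1,\dots,e_d$, and $|n|=(\sum_{i=1}^d n_i^2)^{1/2}$. The discrete Laplacian is $$(\Delta_{disc}\widehat u)(n)=\frac14\sum_{j=1}^d\big(\widehat u(n+e_j)+\widehat u(n-e_j)\big)-\frac d2\,\widehat u(n).$$ $\widehat V$ also denotes the multiplication operator $(\widehat V\widehat u)(n)=\widehat V(n)\widehat u(n)$. $\sigma_p(\widehat H)$ is the point spectrum, i.e. the set of eigenvalues of $\widehat H$ with eigenfunctions in $\ell^2(\mathbf Z^d)$. *)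

theory Defs
  imports "HOL-Analysis.Analysis"
begin

(* The lattice Z^d is the type int ^ 'd, where d = CARD('d). *)

definition lattice_norm :: "int ^ 'd \<Rightarrow> real" where
  "lattice_norm n = sqrt (\<Sum>i\<in>UNIV. (real_of_int (n $ i))\<^sup>2)"

definition ell2 :: "('a \<Rightarrow> complex) set" where
  "ell2 = {u. (\<lambda>n. (cmod (u n))\<^sup>2) summable_on UNIV}"

definition discrete_laplacian :: "(int ^ 'd \<Rightarrow> complex) \<Rightarrow> (int ^ 'd \<Rightarrow> complex)" where
  "discrete_laplacian u =
    (\<lambda>n. (1/4) * (\<Sum>j\<in>UNIV. u (n + axis j 1) + u (n - axis j 1))
          - (of_nat CARD('d) / 2) * u n)"

definition multiplication_operator :: "('a \<Rightarrow> real) \<Rightarrow> ('a \<Rightarrow> complex) \<Rightarrow> ('a \<Rightarrow> complex)" where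
  "multiplication_operator V u = (\<lambda>n. of_real (V n) * u n)"

(* Operators are given by their action on all functions; the restriction to the
   Hilbert space of square-summable functions is made in point_spectrum.  The
   Schroedinger operator of a bounded V maps ell2 into itself. *)

definition schroedinger ::
    "(int ^ 'd \<Rightarrow> real) \<Rightarrow> (int ^ 'd \<Rightarrow> complex) \<Rightarrow> (int ^ 'd \<Rightarrow> complex)" where
  "schroedinger V u =
    (\<lambda>n. - discrete_laplacian u n + multiplication_operator V u n)"

definition point_spectrum :: "(('a \<Rightarrow> complex) \<Rightarrow> ('a \<Rightarrow> complex)) \<Rightarrow> complex set" where
  "point_spectrum T =
    {z. \<exists>u\<in>ell2. u \<noteq> (\<lambda>n. 0) \<and> T u = (\<lambda>n. z * u n)}"

end

theory Submission imports Defs "HOL-Real_Asymp.Real_Asymp" begin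

text \<open>Real and imaginary parts of an eigenfunction solve
  \<open>\<Sum>\<^sub>j (w (n + e\<^sub>j) + w (n - e\<^sub>j)) = c * w n + g n\<close> with \<open>c = 2 d - 4 \<lambda>\<close>, \<open>\<bar>c\<bar> < 2 d\<close>, and \<open>g\<close> finitely
  supported.  Slicing along one coordinate gives \<open>a (k + 1) + a (k - 1) = T (a k) + f k\<close> in
  \<open>l\<^sup>2\<close>, with \<open>T\<close> self-adjoint with symbol \<open>t(x) = c - 2 \<Sum> cos x\<^sub>j\<close>.  Let \<open>v\<close> be the solution of this
  recurrence vanishing for small \<open>k\<close>; its slices are finitely supported.  Beyond the support of \<open>f\<close>
  both \<open>a\<close> (forwards) and \<open>a - v\<close> (backwards) are decaying solutions of the homogeneous recurrence,
  which conservation of energy confines to the spectral region \<open>\<bar>t\<bar> \<ge> 2\<close>: quantitatively, the powers of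
  \<open>D\<^sup>2 - T\<^sup>2\<close> grow on them at most like \<open>(D\<^sup>2 - 4)\<^sup>k\<close>.  Hence the Fourier transform of
  a slice of \<open>v\<close>, a trigonometric polynomial, vanishes on \<open>\<bar>t\<bar> < 2\<close>, a nonempty open set as
  \<open>\<bar>c\<bar> < 2 d\<close>, so the slice is zero.  Then \<open>a - v\<close> solves the homogeneous recurrence and
  decays at both ends, so \<open>a = v\<close>; thus \<open>w\<close> vanishes on a half space, and by unique continuation
  everywhere.\<close>

section \<open>Three-term recurrences in an inner product space\<close>

text \<open>The energy
  \<open>\<parallel>b (n + 1)\<parallel>\<^sup>2 - \<langle>b n, b (n + 2)\<rangle>\<close> does not depend on \<open>n\<close>, so it vanishes for a decaying solution.\<close>

lemma recurrence_energy_zero: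
  fixes b :: "nat \<Rightarrow> 'a::real_inner"
  assumes sym: "\<And>x y. inner (T x) y = inner x (T y)"
    and rec: "\<And>n. b (n + 2) = T (b (n + 1)) - b n"
    and lim: "b \<longlonglongrightarrow> 0"
  shows "inner (b 1) (b 1) = inner (b 0) (b 2)"
proof -
  define E where "E n = inner (b (n + 1)) (b (n + 1)) - inner (b n) (b (n + 2))" for n
  have step: "E (Suc n) = E n" for n
  proof -
    have "b (n + 3) = T (b (n + 2)) - b (n + 1)"
      using rec[of "n + 1"] by (simp add: eval_nat_numeral)
    moreover have "inner (b n) (b (n + 2)) = inner (T (b (n + 1)) - b (n + 2)) (b (n + 2))"
      using rec[of n] by simp
    ultimately show ?thesis
      unfolding E_def
      by (simp add: eval_nat_numeral inner_diff_left inner_diff_right sym inner_commute)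
  qed
  have const: "E n = E 0" for n
    by (induction n) (auto simp: step)
  have "E \<longlonglongrightarrow> inner (0 :: 'a) 0 - inner (0 :: 'a) 0"
    unfolding E_def
    by (intro tendsto_diff tendsto_inner lim LIMSEQ_ignore_initial_segment[OF lim])
  moreover have "E \<longlonglongrightarrow> E 0"
    by (rule tendsto_eventually) (intro always_eventually allI const)
  ultimately have "E 0 = inner (0 :: 'a) 0 - inner (0 :: 'a) 0" by (rule LIMSEQ_unique[rotated])
  then show ?thesis
    by (simp add: E_def numeral_2_eq_2)
qed

text \<open>In spectral terms a decaying solution lives where \<open>T\<^sup>2 \<ge> 4\<close>, and there \<open>D\<^sup>2 - T\<^sup>2\<close> has values
  between \<open>0\<close> and \<open>D\<^sup>2 - 4\<close>.  The energy identity is applied to \<open>b\<close> and to \<open>T \<circ> b\<close>.\<close>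

lemma decaying_recurrence_bound:
  fixes b :: "nat \<Rightarrow> 'a::real_inner"
  assumes lin: "linear T"
    and sym: "\<And>x y. inner (T x) y = inner x (T y)"
    and bdd: "\<And>x. norm (T x) \<le> D * norm x" and D: "D \<ge> 2"
    and rec: "\<And>n. b (n + 2) = T (b (n + 1)) - b n"
    and lim: "b \<longlonglongrightarrow> 0"
  shows "norm (D\<^sup>2 *\<^sub>R b 0 - T (T (b 0))) \<le> (D\<^sup>2 - 4) * norm (b 0)"
proof -
  interpret linear T by (rule lin)
  have blT: "bounded_linear T"
    using bdd by (intro bounded_linear_intro[where K = D] add scale) (simp add: mult.commute)
  \<comment> \<open>Eliminating \<open>c 2\<close> turns the vanishing energy into a relation
    between \<open>c 0\<close> and \<open>c 1\<close> alone.\<close>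
  have id: "inner (c 1) (c 1) + inner (c 0) (c 0) = inner (T (c 0)) (c 1)"
    if "\<And>n. c (n + 2) = T (c (n + 1)) - c n" "c \<longlonglongrightarrow> 0" for c :: "nat \<Rightarrow> 'a"
  proof -
    have "c 2 = T (c 1) - c 0" using that(1)[of 0] by (simp add: numeral_2_eq_2)
    then show ?thesis
      using recurrence_energy_zero[OF sym that] by (simp add: inner_diff_right sym)
  qed
  let ?x = "b 0" and ?y = "b 1"
  have i1: "inner ?y ?y + inner ?x ?x = inner (T ?x) ?y"
    by (rule id[OF rec lim])
  have "(\<lambda>n. T (b n)) \<longlonglongrightarrow> T 0"
    by (rule bounded_linear.tendsto[OF blT lim])
  then have i2: "inner (T ?y) (T ?y) + inner (T ?x) (T ?x) = inner (T (T ?x)) (T ?y)"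
    using id[of "\<lambda>n. T (b n)"] diff[of "T (b (n + 1))" "b n" for n]
    by (simp only: rec linear_0[OF lin])
  \<comment> \<open>Completing the square: by \<open>i1\<close> and \<open>i2\<close> the squared
    norms of \<open>p\<close> and \<open>T p\<close> are \<open>Y / 4 - X\<close> and
    \<open>Z / 4 - Y\<close>, with \<open>X\<close>, \<open>Y\<close>, \<open>Z\<close> as below.
    Nonnegativity of the first yields \<open>h1\<close>, and the bound on \<open>T\<close> at
    \<open>p\<close> yields \<open>h2\<close>.\<close>
  define p where "p = ?y - (1/2) *\<^sub>R T ?x"
  have Tp: "T p = T ?y - (1/2) *\<^sub>R T (T ?x)"
    by (simp add: p_def diff scale)
  have p1: "inner p p = inner ?y ?y - inner (T ?x) ?y + inner (T ?x) (T ?x) / 4"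
    by (simp add: p_def inner_diff_left inner_diff_right inner_commute)
  have p2: "inner (T p) (T p) = inner (T ?y) (T ?y) - inner (T (T ?x)) (T ?y)
      + inner (T (T ?x)) (T (T ?x)) / 4"
    by (simp add: Tp inner_diff_left inner_diff_right inner_commute)
  define X Y Z where "X = inner ?x ?x" and "Y = inner (T ?x) (T ?x)"
    and "Z = inner (T (T ?x)) (T (T ?x))"
  have sq: "inner (T v) (T v) \<le> D\<^sup>2 * inner v v" for v
    using power_mono[OF bdd[of v], of 2] by (simp add: power_mult_distrib power2_norm_eq_inner)
  have h1: "4 * X \<le> Y"
    using inner_ge_zero[of p] p1 i1 by (simp add: X_def Y_def)
  have "inner p p = Y / 4 - X" "inner (T p) (T p) = Z / 4 - Y"
    using p1 p2 i1 i2 by (simp_all add: X_def Y_def Z_def)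
  then have "Z / 4 - Y \<le> D\<^sup>2 * (Y / 4 - X)"
    using sq[of p] by (simp only:)
  then have h2: "Z \<le> 4 * Y + D\<^sup>2 * Y - 4 * D\<^sup>2 * X"
    by (simp add: algebra_simps)
  have B: "D\<^sup>2 - 4 \<ge> 0"
    using power_mono[OF D, of 2] by simp
  have "(norm (D\<^sup>2 *\<^sub>R ?x - T (T ?x)))\<^sup>2 = D^4 * X - 2 * D\<^sup>2 * Y + Z"
    unfolding power2_norm_eq_inner X_def Y_def Z_def
    using sym[of ?x "T ?x"]
    by (simp add: inner_diff_left inner_diff_right inner_commute algebra_simps
        power2_eq_square power4_eq_xxxx)
  also have "\<dots> \<le> D^4 * X - D\<^sup>2 * Y + 4 * Y - 4 * D\<^sup>2 * X"
    using h2 by linarith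
  also have "\<dots> = (D\<^sup>2 - 4) * (D\<^sup>2 * X - Y)"
    by (simp add: algebra_simps power2_eq_square power4_eq_xxxx)
  also have "\<dots> \<le> (D\<^sup>2 - 4) * ((D\<^sup>2 - 4) * X)"
    using h1 B by (intro mult_left_mono) (auto simp: algebra_simps)
  also have "\<dots> = ((D\<^sup>2 - 4) * norm ?x)\<^sup>2"
    by (simp add: X_def power_mult_distrib power2_norm_eq_inner power2_eq_square[of "D\<^sup>2 - 4"])
  finally show ?thesis
    using B by (metis norm_ge_zero power2_le_imp_le split_mult_pos_le)
qed

text \<open>The operator \<open>D\<^sup>2 - T\<^sup>2\<close> commutes with \<open>T\<close>, so it
  maps decaying solutions to decaying solutions, and the one-step bound can be iterated.\<close>

lemma decaying_recurrence_power_bound: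
  fixes b :: "nat \<Rightarrow> 'a::real_inner"
  assumes lin: "linear T"
    and sym: "\<And>x y. inner (T x) y = inner x (T y)"
    and bdd: "\<And>x. norm (T x) \<le> D * norm x" and D: "D \<ge> 2"
    and rec: "\<And>n. b (n + 2) = T (b (n + 1)) - b n"
    and lim: "b \<longlonglongrightarrow> 0"
  shows "norm (((\<lambda>x. D\<^sup>2 *\<^sub>R x - T (T x)) ^^ k) (b 0)) \<le> (D\<^sup>2 - 4) ^ k * norm (b 0)"
  using rec lim
proof (induction k arbitrary: b)
  case (Suc k)
  interpret linear T by (rule lin)
  let ?S = "\<lambda>x. D\<^sup>2 *\<^sub>R x - T (T x)"
  have blT: "bounded_linear T"
    using bdd by (intro bounded_linear_intro[where K = D] add scale) (simp add: mult.commute)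
  have B: "D\<^sup>2 - 4 \<ge> 0"
    using power_mono[OF D, of 2] by simp
  have "?S (b (n + 2)) = T (?S (b (n + 1))) - ?S (b n)" for n
    using Suc.prems(1)[of n] diff[of "T (b (n + 1))" "b n"] diff[of "T (T (b (n + 1)))" "T (b n)"]
    by (simp only: diff scale scaleR_diff_right) (simp add: algebra_simps)
  moreover have "(\<lambda>n. ?S (b n)) \<longlonglongrightarrow> D\<^sup>2 *\<^sub>R 0 - T (T 0)"
    by (intro tendsto_intros bounded_linear.tendsto[OF blT] Suc.prems(2))
  ultimately have "norm ((?S ^^ k) (?S (b 0))) \<le> (D\<^sup>2 - 4) ^ k * norm (?S (b 0))"
    using Suc.IH[of "\<lambda>n. ?S (b n)"] by simp
  also have "\<dots> \<le> (D\<^sup>2 - 4) ^ k * ((D\<^sup>2 - 4) * norm (b 0))"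
    using B by (intro mult_left_mono decaying_recurrence_bound[OF lin sym bdd D Suc.prems]) auto
  finally show ?case
    by (simp add: funpow_Suc_right mult.assoc mult.left_commute del: funpow.simps)
qed auto

text \<open>By the energy identity \<open>\<parallel>z k\<parallel>\<^sup>2\<close> is a convex sequence, here tending to zero at both ends.\<close>

lemma two_sided_decaying_recurrence_zero:
  fixes z :: "int \<Rightarrow> 'a::real_inner"
  assumes sym: "\<And>x y. inner (T x) y = inner x (T y)"
    and rec: "\<And>k. z (k + 1) + z (k - 1) = T (z k)"
    and lim1: "(\<lambda>n. z (int n)) \<longlonglongrightarrow> 0" and lim2: "(\<lambda>n. z (- int n)) \<longlonglongrightarrow> 0"
  shows "z k = 0"
proof -
  have shift1: "(\<lambda>n. z (k + int n)) \<longlonglongrightarrow> 0" for k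
  proof -
    have "(\<lambda>n. z (k + int (n + nat (- k)))) \<longlonglongrightarrow> 0"
      using LIMSEQ_ignore_initial_segment[OF lim1, of "nat k"]
      by (cases "k \<ge> 0") (simp_all add: algebra_simps lim1)
    then show ?thesis by (rule LIMSEQ_offset)
  qed
  have shift2: "(\<lambda>n. z (k - int n)) \<longlonglongrightarrow> 0" for k
  proof -
    have "(\<lambda>n. z (k - int (n + nat k))) \<longlonglongrightarrow> 0"
      using LIMSEQ_ignore_initial_segment[OF lim2, of "nat (- k)"]
      by (cases "k \<ge> 0") (simp_all add: algebra_simps lim2)
    then show ?thesis by (rule LIMSEQ_offset)
  qed
  define N where "N k = (norm (z k))\<^sup>2" for k
  have conv: "2 * N k \<le> N (k + 1) + N (k - 1)" for k
  proof -
    have "z ((k - 1) + int (n + 2)) = T (z ((k - 1) + int (n + 1))) - z ((k - 1) + int n)" for n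
      using rec[of "k + int n"] by (simp add: algebra_simps)
    from recurrence_energy_zero[OF sym this shift1]
    have "N k = inner (z (k - 1)) (z (k + 1))"
      by (simp add: N_def power2_norm_eq_inner add.commute)
    \<comment> \<open>Expanding this square bounds \<open>2 * inner (z (k - 1)) (z (k + 1))\<close>
      by \<open>N (k + 1) + N (k - 1)\<close>.\<close>
    moreover have "0 \<le> (norm (z (k + 1) - z (k - 1)))\<^sup>2" by simp
    ultimately show ?thesis
      unfolding N_def power2_norm_eq_inner
      by (simp add: inner_diff_left inner_diff_right inner_commute)
  qed
  have mono: "N (j + 1) - N j \<le> N (j + int n + 1) - N (j + int n)" for j n
  proof (induction n)
    case (Suc n)
    then show ?case using conv[of "j + int n + 1"] by (simp add: algebra_simps)
  qed auto
  \<comment> \<open>The induction step compares the increment of \<open>N\<close> at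
    \<open>k - n - 1\<close> with the one \<open>2 * n + 1\<close> places later, at
    \<open>k + n\<close>.\<close>
  have "2 * N k \<le> N (k + int n) + N (k - int n)" for n
  proof (induction n)
    case (Suc n)
    then show ?case using mono[of "k - int n - 1" "2 * n + 1"] by (simp add: algebra_simps)
  qed auto
  moreover have "(\<lambda>n. N (k + int n) + N (k - int n)) \<longlonglongrightarrow> (norm (0::'a))\<^sup>2 + (norm (0::'a))\<^sup>2"
    unfolding N_def by (intro tendsto_intros shift1 shift2)
  ultimately have "2 * N k \<le> 0"
    by (intro LIMSEQ_le_const[where a = "2 * N k" and x = 0]) auto
  then show ?thesis by (simp add: N_def)
qed

text \<open>The part of the argument that is independent of the Fourier transform. \<open>P\<close>
  stands for the finitely supported slices. The assumption \<open>small\<close> is the spectral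
  input: an element of \<open>P\<close> living where \<open>\<bar>t\<bar> \<ge> 2\<close>, which is
  expressed by the growth of powers, is zero.\<close>

lemma forced_recurrence_eventually_zero:
  fixes a f :: "int \<Rightarrow> 'a::real_inner" and R :: int
  assumes lin: "linear T"
    and sym: "\<And>x y. inner (T x) y = inner x (T y)"
    and bdd: "\<And>x. norm (T x) \<le> D * norm x" and D: "D \<ge> 2"
    and rec: "\<And>k. a (k + 1) + a (k - 1) = T (a k) + f k"
    and supp: "\<And>k. \<bar>k\<bar> > R \<Longrightarrow> f k = 0"
    and lim1: "(\<lambda>n. a (int n)) \<longlonglongrightarrow> 0" and lim2: "(\<lambda>n. a (- int n)) \<longlonglongrightarrow> 0"
    and P: "subspace P" and TP: "\<And>x. x \<in> P \<Longrightarrow> T x \<in> P" and fP: "\<And>k. f k \<in> P"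
    and small: "\<And>p K. p \<in> P \<Longrightarrow>
      (\<And>k. norm (((\<lambda>x. D\<^sup>2 *\<^sub>R x - T (T x)) ^^ k) p) \<le> K * (D\<^sup>2 - 4) ^ k) \<Longrightarrow> p = 0"
    and k: "k \<ge> \<bar>R\<bar>"
  shows "a k = 0"
proof -
  interpret linear T by (rule lin)
  let ?S = "\<lambda>x. D\<^sup>2 *\<^sub>R x - T (T x)"
  \<comment> \<open>\<open>w n\<close> is the pair of values of \<open>v\<close> at
    \<open>n - R - 1\<close> and \<open>n - R\<close>. Both are zero for \<open>n = 0\<close>, and
    \<open>nat\<close> sends every smaller index to this initial pair, so \<open>v\<close> vanishes
    up to \<open>- R\<close>.\<close>
  define w :: "nat \<Rightarrow> 'a \<times> 'a" where
    "w = rec_nat (0, 0) (\<lambda>n (x, y). (y, T y - x + f (int n - R)))"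
  define v where "v k = fst (w (nat (k + R + 1)))" for k
  have v0: "v k = 0" if "k \<le> - R" for k
  proof -
    have "k + R + 1 \<le> 0 \<or> nat (k + R + 1) = 1" using that by linarith
    then show ?thesis by (auto simp: v_def w_def)
  qed
  have wS: "w (Suc n) = (snd (w n), T (snd (w n)) - fst (w n) + f (int n - R))" for n
    by (simp add: w_def split_beta)
  have vrec: "v (k + 1) + v (k - 1) = T (v k) + f k" for k
  proof (cases "k \<ge> - R")
    case True
    define n where "n = nat (k + R)"
    have k: "k = int n - R" using True by (simp add: n_def)
    show ?thesis by (simp add: v_def k nat_add_distrib wS flip: Suc_eq_plus1)
  next
    case False
    then show ?thesis using supp[of k] by (simp add: v0)
  qed
  have "fst (w n) \<in> P \<and> snd (w n) \<in> P" for n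
  proof (induction n)
    case 0
    then show ?case using subspace_0[OF P] by (simp add: w_def)
  next
    case (Suc n)
    then show ?case unfolding wS by (auto intro!: subspace_add[OF P] subspace_diff[OF P] TP fP)
  qed
  then have vP: "v k \<in> P" for k by (simp add: v_def)
  define z where "z k = a k - v k" for k
  have zrec: "z (k + 1) + z (k - 1) = T (z k)" for k
    using rec[of k] vrec[of k] by (simp add: z_def diff algebra_simps)
  have lin_S: "linear ?S"
    by (intro linear_compose_sub linear_compose_scale_right linear_id[unfolded id_def]
        linear_compose[OF lin lin, unfolded o_def])
  have lin_Sk: "linear (?S ^^ n)" for n
    by (induction n) (auto simp: o_def id_def intro: linear_id[unfolded id_def]
        linear_compose[OF _ lin_S, unfolded o_def])
  have zlim2: "(\<lambda>n. z (- int n)) \<longlonglongrightarrow> 0"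
  proof (rule Lim_transform_eventually[OF lim2])
    show "eventually (\<lambda>n. a (- int n) = z (- int n)) sequentially"
      using eventually_ge_at_top[of "nat R"] by eventually_elim (simp add: z_def v0)
  qed
  \<comment> \<open>From \<open>k\<close> on, \<open>a\<close> solves the homogeneous recurrence
    forwards; the first source term met is \<open>f (k + 1)\<close>, so
    \<open>k = \<bar>R\<bar>\<close> is admissible. Backwards \<open>z\<close> solves it everywhere.
    Both obey the power bound, hence so does their difference \<open>v\<close>.\<close>
  have v1: "v k = 0" if k: "k \<ge> \<bar>R\<bar>" for k
  proof (rule small[OF vP])
    fix n
    have "k \<ge> 0" using k by linarith
    have "(\<lambda>n. a (int (n + nat k))) \<longlonglongrightarrow> 0"
      by (rule LIMSEQ_ignore_initial_segment[OF lim1])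
    then have l1: "(\<lambda>n. a (k + int n)) \<longlonglongrightarrow> 0" using \<open>k \<ge> 0\<close>
      by (simp add: add.commute)
    have "a (k + int (n + 2)) = T (a (k + int (n + 1))) - a (k + int n)" for n
      using rec[of "k + int n + 1"] supp[of "k + int n + 1"] k by (simp add: algebra_simps)
    from decaying_recurrence_power_bound[OF lin sym bdd D this l1]
    have 1: "norm ((?S ^^ n) (a k)) \<le> (D\<^sup>2 - 4) ^ n * norm (a k)" by simp
    have "(\<lambda>n. z (k - int (n + nat k))) \<longlonglongrightarrow> 0"
      using zlim2 \<open>k \<ge> 0\<close> by simp
    then have l2: "(\<lambda>n. z (k - int n)) \<longlonglongrightarrow> 0" by (rule LIMSEQ_offset)
    have "z (k - int (n + 2)) = T (z (k - int (n + 1))) - z (k - int n)" for n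
      using zrec[of "k - int n - 1"] by (simp add: algebra_simps)
    from decaying_recurrence_power_bound[OF lin sym bdd D this l2]
    have 2: "norm ((?S ^^ n) (z k)) \<le> (D\<^sup>2 - 4) ^ n * norm (z k)" by simp
    have "(?S ^^ n) (v k) = (?S ^^ n) (a k) - (?S ^^ n) (z k)"
      using linear_diff[OF lin_Sk[of n], of "a k" "z k"] by (simp add: z_def)
    then have "norm ((?S ^^ n) (v k)) \<le> norm ((?S ^^ n) (a k)) + norm ((?S ^^ n) (z k))"
      by (simp add: norm_triangle_ineq4)
    also have "\<dots> \<le> (norm (a k) + norm (z k)) * (D\<^sup>2 - 4) ^ n"
      using 1 2 by (simp add: algebra_simps)
    finally show "norm ((?S ^^ n) (v k)) \<le> (norm (a k) + norm (z k)) * (D\<^sup>2 - 4) ^ n" .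
  qed
  have zlim1: "(\<lambda>n. z (int n)) \<longlonglongrightarrow> 0"
  proof (rule Lim_transform_eventually[OF lim1])
    show "eventually (\<lambda>n. a (int n) = z (int n)) sequentially"
      using eventually_ge_at_top[of "nat \<bar>R\<bar>"] by eventually_elim (simp add: z_def v1)
  qed
  have "z k = 0"
    by (rule two_sided_decaying_recurrence_zero[OF sym zrec zlim1 zlim2])
  then show ?thesis using v1[OF k] by (simp add: z_def)
qed

section \<open>Square-summable real functions\<close>

text \<open>A type rather than a set, so that the results for the class \<open>real_inner\<close>
  apply; real-valued, because real and imaginary parts of an eigenfunction are treated
  separately.\<close>

typedef 'a l2 = "{x :: 'a \<Rightarrow> real. (\<lambda>i. (x i)\<^sup>2) summable_on UNIV}"
  morphisms l2_apply Abs_l2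
  by (rule exI[of _ "\<lambda>_. 0"]) simp

setup_lifting type_definition_l2

lemma l2_eqI: "(\<And>i. l2_apply x i = l2_apply y i) \<Longrightarrow> x = y"
  by (rule iffD1[OF l2_apply_inject]) (rule ext)

lemma l2_summable: "(\<lambda>i. (l2_apply x i)\<^sup>2) summable_on UNIV"
  using l2_apply[of x] by simp

lemma summable_on_mult_of_squares:
  fixes x y :: "'a \<Rightarrow> real"
  assumes "(\<lambda>i. (x i)\<^sup>2) summable_on A" "(\<lambda>i. (y i)\<^sup>2) summable_on A"
  shows "(\<lambda>i. x i * y i) summable_on A"
proof -
  have "(\<lambda>i. (x i)\<^sup>2 + (y i)\<^sup>2) summable_on A"
    by (intro summable_on_add assms)
  moreover have "\<bar>x i * y i\<bar> \<le> (x i)\<^sup>2 + (y i)\<^sup>2" for i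
    using sum_squares_bound[of "\<bar>x i\<bar>" "\<bar>y i\<bar>"] abs_ge_zero[of "x i * y i"]
    unfolding abs_mult power2_abs by linarith
  ultimately have "(\<lambda>i. norm (x i * y i)) summable_on A"
    by (intro Infinite_Sum.abs_summable_on_comparison_test'
          [where g = "\<lambda>i. (x i)\<^sup>2 + (y i)\<^sup>2"]) auto
  then show ?thesis by (rule abs_summable_summable)
qed

instantiation l2 :: (type) real_vector
begin

lift_definition zero_l2 :: "'a l2" is "\<lambda>_. 0" by simp

lift_definition plus_l2 :: "'a l2 \<Rightarrow> 'a l2 \<Rightarrow> 'a l2" is "\<lambda>x y i. x i + y i"
  unfolding power2_sum
  by (intro summable_on_add summable_on_mult_of_squares)
     (auto simp: mult.assoc intro!: summable_on_cmult_right summable_on_mult_of_squares)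

lift_definition uminus_l2 :: "'a l2 \<Rightarrow> 'a l2" is "\<lambda>x i. - x i" by simp

lift_definition scaleR_l2 :: "real \<Rightarrow> 'a l2 \<Rightarrow> 'a l2" is "\<lambda>r x i. r * x i"
  by (simp add: power_mult_distrib summable_on_cmult_right)

definition minus_l2 :: "'a l2 \<Rightarrow> 'a l2 \<Rightarrow> 'a l2" where "minus_l2 x y = x + - y"

instance
  by standard
    (rule l2_eqI,
     simp add: zero_l2.rep_eq plus_l2.rep_eq uminus_l2.rep_eq scaleR_l2.rep_eq minus_l2_def
       algebra_simps)+

end

instantiation l2 :: (type) real_inner
begin

definition inner_l2 :: "'a l2 \<Rightarrow> 'a l2 \<Rightarrow> real" where
  "inner_l2 x y = (\<Sum>\<^sub>\<infinity>i. l2_apply x i * l2_apply y i)"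

definition norm_l2 :: "'a l2 \<Rightarrow> real" where "norm_l2 x = sqrt (inner x x)"
definition sgn_l2 :: "'a l2 \<Rightarrow> 'a l2" where "sgn_l2 x = x /\<^sub>R norm x"
definition dist_l2 :: "'a l2 \<Rightarrow> 'a l2 \<Rightarrow> real" where "dist_l2 x y = norm (x - y)"
definition uniformity_l2 :: "('a l2 \<times> 'a l2) filter" where
  "uniformity_l2 = (INF e\<in>{0<..}. principal {(x, y). dist x y < e})"
definition open_l2 :: "'a l2 set \<Rightarrow> bool" where
  "open_l2 U \<longleftrightarrow> (\<forall>x\<in>U. eventually (\<lambda>(x', y). x' = x \<longrightarrow> y \<in> U) uniformity)"

instance
proof
  have sm: "(\<lambda>i. l2_apply x i * l2_apply y i) summable_on UNIV" for x y :: "'a l2"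
    by (intro summable_on_mult_of_squares l2_summable)
  fix x y z :: "'a l2" and r :: real
  show "dist x y = norm (x - y)" by (rule dist_l2_def)
  show "sgn x = x /\<^sub>R norm x" by (rule sgn_l2_def)
  show "uniformity = (INF e\<in>{0<..}. principal {(x :: 'a l2, y). dist x y < e})"
    by (rule uniformity_l2_def)
  show "open U \<longleftrightarrow> (\<forall>x\<in>U. eventually (\<lambda>(x', y). x' = x \<longrightarrow> y \<in> U) uniformity)"
    for U :: "'a l2 set" by (rule open_l2_def)
  show "inner x y = inner y x" by (simp add: inner_l2_def mult.commute)
  show "inner (x + y) z = inner x z + inner y z"
    unfolding inner_l2_def plus_l2.rep_eq distrib_right by (rule infsum_add) (rule sm)+
  show "inner (r *\<^sub>R x) y = r * inner x y"
    unfolding inner_l2_def scaleR_l2.rep_eq mult.assoc by (rule infsum_cmult_right) (rule sm)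
  show ge: "0 \<le> inner x x"
    unfolding inner_l2_def by (rule infsum_nonneg) simp
  show "norm x = sqrt (inner x x)" by (rule norm_l2_def)
  show "inner x x = 0 \<longleftrightarrow> x = 0"
  proof
    assume "inner x x = 0"
    then have le: "(\<Sum>\<^sub>\<infinity>i. l2_apply x i * l2_apply x i) \<le> 0"
      by (simp add: inner_l2_def)
    have "l2_apply x i * l2_apply x i = 0" for i
      by (rule nonneg_infsum_le_0D[OF le sm[of x x], of i]) simp_all
    then show "x = 0" by (intro l2_eqI) (simp add: zero_l2.rep_eq)
  qed (simp add: inner_l2_def zero_l2.rep_eq)
qed

end

lemma l2_apply_diff: "l2_apply (x - y) i = l2_apply x i - l2_apply y i"
  unfolding minus_l2_def plus_l2.rep_eq uminus_l2.rep_eq by simp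

lemma l2_apply_sum: "l2_apply (\<Sum>j\<in>J. x j) i = (\<Sum>j\<in>J. l2_apply (x j) i)"
  by (induction J rule: infinite_finite_induct) (auto simp: zero_l2.rep_eq plus_l2.rep_eq)

lemmas l2_apply_simps =
  zero_l2.rep_eq plus_l2.rep_eq uminus_l2.rep_eq scaleR_l2.rep_eq l2_apply_diff l2_apply_sum

lemma norm_l2_power2: "(norm x)\<^sup>2 = (\<Sum>\<^sub>\<infinity>i. (l2_apply x i)\<^sup>2)"
  unfolding power2_norm_eq_inner inner_l2_def by (simp add: power2_eq_square)

lemma sum_power2_le_norm_l2: "finite F \<Longrightarrow> (\<Sum>i\<in>F. (l2_apply x i)\<^sup>2) \<le> (norm x)\<^sup>2"
  unfolding norm_l2_power2 by (rule finite_sum_le_infsum[OF l2_summable]) simp_all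

text \<open>Cauchy-Schwarz against the constant 1 on \<open>F\<close>. It makes the norm control the
  Fourier transform pointwise.\<close>

lemma sum_abs_le_norm_l2:
  assumes "finite F"
  shows "(\<Sum>i\<in>F. \<bar>l2_apply x i\<bar>) \<le> sqrt (real (card F)) * norm x"
proof -
  have "(\<Sum>i\<in>F. \<bar>l2_apply x i\<bar>)\<^sup>2 \<le> (\<Sum>i\<in>F. \<bar>l2_apply x i\<bar>\<^sup>2) * (\<Sum>i\<in>F. 1\<^sup>2)"
    using Cauchy_Schwarz_ineq_sum[of "\<lambda>i. \<bar>l2_apply x i\<bar>" "\<lambda>_. 1" F] by simp
  also have "\<dots> \<le> (norm x)\<^sup>2 * real (card F)"
    using mult_right_mono[OF sum_power2_le_norm_l2[OF assms, of x], of "real (card F)"] by simp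
  also have "\<dots> = (sqrt (real (card F)) * norm x)\<^sup>2"
    by (simp add: power_mult_distrib)
  finally show ?thesis by (rule power2_le_imp_le) simp
qed

section \<open>Translation operators\<close>

lift_definition shift :: "'a::ab_group_add \<Rightarrow> 'a l2 \<Rightarrow> 'a l2" is "\<lambda>h x i. x (i + h)"
proof -
  fix h :: 'a and x :: "'a \<Rightarrow> real"
  assume *: "(\<lambda>i. (x i)\<^sup>2) summable_on UNIV"
  have "bij (\<lambda>i. i + h)" by (rule bij_plus_right)
  then show "(\<lambda>i. (x (i + h))\<^sup>2) summable_on UNIV"
    using * summable_on_reindex_bij_betw[of "\<lambda>i. i + h" UNIV UNIV "\<lambda>i. (x i)\<^sup>2"] by simp
qed

lemma linear_shift: "linear (shift h)"
proof (rule linearI)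
  show "shift h (x + y) = shift h x + shift h y" for x y
    by (rule l2_eqI) (simp only: shift.rep_eq plus_l2.rep_eq)
  show "shift h (r *\<^sub>R x) = r *\<^sub>R shift h x" for r x
    by (rule l2_eqI) (simp only: shift.rep_eq scaleR_l2.rep_eq)
qed

lemma inner_shift: "inner (shift h x) y = inner x (shift (- h) y)"
proof -
  have "(\<Sum>\<^sub>\<infinity>i. l2_apply x (i + h) * l2_apply y (i + h + - h)) =
    (\<Sum>\<^sub>\<infinity>i. l2_apply x i * l2_apply y (i + - h))"
    by (rule infsum_reindex_bij_betw[OF bij_plus_right])
  then show ?thesis
    by (simp only: inner_l2_def shift.rep_eq add.assoc add.right_inverse add_0_right)
qed

lemma norm_shift: "norm (shift h x) = norm x"
proof -
  have "shift (- h) (shift h x) = x"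
    by (rule l2_eqI) (simp only: shift.rep_eq add.assoc add.left_inverse add_0_right)
  then show ?thesis by (simp only: norm_eq_sqrt_inner inner_shift)
qed

section \<open>Exponential sums\<close>

text \<open>Differentiating the relation and subtracting \<open>\<i> * f a\<close> times it removes
  the term of \<open>a\<close> and multiplies every other coefficient by
  \<open>\<i> * (f m - f a)\<close>, which is nonzero by injectivity. Induction on \<open>A\<close>
  then applies.\<close>

lemma exponential_sum_zero_imp_coeffs_zero:
  fixes c :: "'a \<Rightarrow> complex" and f :: "'a \<Rightarrow> real"
  assumes "finite A" "inj_on f A" "\<eta> > 0"
    and "\<And>s. \<bar>s\<bar> < \<eta> \<Longrightarrow> (\<Sum>m\<in>A. c m * cis (s * f m)) = 0"
  shows "\<forall>m\<in>A. c m = 0"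
  using assms(1,2,4)
proof (induction A arbitrary: c rule: finite_induct)
  case (insert a A)
  let ?F = "\<lambda>s. \<Sum>m\<in>insert a A. c m * cis (s * f m)"
  have "c m * (\<i> * of_real (f m - f a)) = 0" if "m \<in> A" for m
  proof -
    have "(\<Sum>m\<in>A. c m * (\<i> * of_real (f m - f a)) * cis (s * f m)) = 0" if s: "\<bar>s\<bar> < \<eta>" for s
    proof -
      have d: "(?F has_vector_derivative (\<Sum>m\<in>insert a A. c m * (\<i> * of_real (f m) * cis (s * f m)))) (at s)"
      proof (intro has_vector_derivative_sum has_vector_derivative_mult_right)
        fix m
        have "((\<lambda>t. cis (t * f m)) has_vector_derivative f m *\<^sub>R (\<i> * cis (s * f m))) (at s)"
          unfolding has_vector_derivative_def
          by (auto intro!: derivative_eq_intros simp: scaleR_conv_of_real mult_ac)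
        then show "((\<lambda>t. cis (t * f m)) has_vector_derivative \<i> * of_real (f m) * cis (s * f m)) (at s)"
          by (simp add: scaleR_conv_of_real mult_ac)
      qed
      have "((\<lambda>_. 0) has_vector_derivative (\<Sum>m\<in>insert a A. c m * (\<i> * of_real (f m) * cis (s * f m)))) (at s)"
        by (rule has_vector_derivative_transform_within_open[OF d, of "{- \<eta><..<\<eta>}"])
           (use s insert.prems(2) in auto)
      then have "(\<Sum>m\<in>insert a A. c m * (\<i> * of_real (f m) * cis (s * f m))) = 0"
        by (rule vector_derivative_unique_at) auto
      moreover have "\<i> * of_real (f a) * ?F s = 0"
        using insert.prems(2)[OF s] by simp
      ultimately have "0 = (\<Sum>m\<in>insert a A. c m * (\<i> * of_real (f m) * cis (s * f m)))
          - \<i> * of_real (f a) * ?F s"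
        by simp
      also have "\<dots> = (\<Sum>m\<in>insert a A. c m * (\<i> * of_real (f m - f a)) * cis (s * f m))"
        by (simp add: sum_distrib_left sum_subtractf[symmetric] algebra_simps del: sum.insert)
      also have "\<dots> = (\<Sum>m\<in>A. c m * (\<i> * of_real (f m - f a)) * cis (s * f m))"
        using insert.hyps by simp
      finally show ?thesis by simp
    qed
    then have "\<forall>m\<in>A. c m * (\<i> * of_real (f m - f a)) = 0"
      using insert.prems(1) by (intro insert.IH) auto
    then show ?thesis using that by blast
  qed
  have A: "c m = 0" if "m \<in> A" for m
  proof -
    have "f m \<noteq> f a"
      using insert.prems(1) insert.hyps(2) that by (metis inj_on_contraD insertI1 insertI2)
    then have "\<i> * complex_of_real (f m - f a) \<noteq> 0" by simp
    then show ?thesis using that \<open>\<And>m. m \<in> A \<Longrightarrow> c m * (\<i> * of_real (f m - f a)) = 0\<close>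
      by (metis mult_eq_0_iff)
  qed
  \<comment> \<open>With the other coefficients gone, the relation at \<open>s = 0\<close> reads
    \<open>c a = 0\<close>.\<close>
  have "(\<Sum>m\<in>A. c m) = 0" by (rule sum.neutral) (use A in blast)
  then have "c a = 0"
    using insert.prems(2)[of 0] insert.hyps \<open>\<eta> > 0\<close> by simp
  with A show ?case by simp
qed simp

definition phase :: "real ^ 'd \<Rightarrow> int ^ 'd \<Rightarrow> real" where
  "phase x m = (\<Sum>i\<in>UNIV. x $ i * real_of_int (m $ i))"

lemma phase_diff_right: "phase x (m - h) = phase x m - phase x h"
  by (simp add: phase_def sum_subtractf algebra_simps)

lemma phase_add_left: "phase (x + y) m = phase x m + phase y m"
  by (simp add: phase_def sum.distrib algebra_simps)

lemma phase_scaleR_left: "phase (s *\<^sub>R x) m = s * phase x m"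
  by (simp add: phase_def sum_distrib_left mult_ac)

lemma phase_axis: "phase x (axis j 1) = x $ j"
proof -
  have "phase x (axis j 1) = (\<Sum>i\<in>UNIV. if i = j then x $ i else 0)"
    unfolding phase_def by (intro sum.cong) (auto simp: axis_def)
  then show ?thesis by simp
qed

text \<open>The \<open>x\<close> that give two distinct points of \<open>A\<close> the same phase
  fill finitely many hyperplanes, and these are too small to cover the space.\<close>

lemma exists_inj_on_phase:
  assumes "finite (A :: (int ^ 'd) set)"
  shows "\<exists>x. inj_on (phase x) A"
proof -
  define H :: "int ^ 'd \<Rightarrow> (real ^ 'd) set" where "H h = {x. phase x h = 0}" for h
  have "negligible (H h)" if "h \<noteq> 0" for h
  proof -
    let ?v = "(\<chi> i. real_of_int (h $ i)) :: real ^ 'd"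
    have "?v \<noteq> 0" using that by (auto simp: vec_eq_iff)
    then have "negligible {x. ?v \<bullet> x = 0}" by (simp add: negligible_hyperplane)
    then show ?thesis by (simp add: H_def phase_def inner_vec_def mult.commute)
  qed
  then have "negligible (\<Union>p\<in>{(m, n) \<in> A \<times> A. m \<noteq> n}. H (fst p - snd p))"
    using assms by (intro negligible_Union) (auto intro: finite_subset[of _ "A \<times> A"])
  then have "(\<Union>p\<in>{(m, n) \<in> A \<times> A. m \<noteq> n}. H (fst p - snd p)) \<noteq> UNIV"
    by (metis non_negligible_UNIV)
  then obtain x where "x \<notin> (\<Union>p\<in>{(m, n) \<in> A \<times> A. m \<noteq> n}. H (fst p - snd p))"
    by blast
  then have "inj_on (phase x) A"
    by (auto simp: inj_on_def H_def phase_diff_right)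
  then show ?thesis ..
qed

text \<open>Restriction to a line through \<open>x0\<close> whose direction \<open>w\<close>
  separates the frequencies reduces this to one variable; the factors
  \<open>cis (phase x0 m)\<close> are absorbed into the coefficients.\<close>

lemma trigonometric_polynomial_zero_imp_coeffs_zero:
  fixes c :: "int ^ 'd \<Rightarrow> complex"
  assumes A: "finite A" and U: "open U" "x0 \<in> U"
    and z: "\<And>x. x \<in> U \<Longrightarrow> (\<Sum>m\<in>A. c m * cis (phase x m)) = 0"
  shows "\<forall>m\<in>A. c m = 0"
proof -
  obtain w where w: "inj_on (phase w) A"
    using exists_inj_on_phase[OF A] by blast
  have "((\<lambda>s. x0 + s *\<^sub>R w) \<longlongrightarrow> x0 + 0 *\<^sub>R w) (at (0::real))"
    by (intro tendsto_intros)
  then have "eventually (\<lambda>s. x0 + s *\<^sub>R w \<in> U) (at (0::real))"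
    using U by (auto dest: topological_tendstoD)
  then obtain \<eta> where \<eta>: "\<eta> > 0" "\<And>s. s \<noteq> 0 \<Longrightarrow> \<bar>s\<bar> < \<eta> \<Longrightarrow> x0 + s *\<^sub>R w \<in> U"
    by (auto simp: eventually_at dist_real_def)
  have "x0 + s *\<^sub>R w \<in> U" if "\<bar>s\<bar> < \<eta>" for s
    using \<eta>(2)[of s] that U by (cases "s = 0") auto
  then have "(\<Sum>m\<in>A. c m * cis (phase x0 m) * cis (s * phase w m)) = 0" if "\<bar>s\<bar> < \<eta>" for s
    using z[of "x0 + s *\<^sub>R w"] that
    by (simp add: phase_add_left phase_scaleR_left cis_mult[symmetric] mult.assoc)
  then have "\<forall>m\<in>A. c m * cis (phase x0 m) = 0"
    by (intro exponential_sum_zero_imp_coeffs_zero[OF A w \<eta>(1)])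
  then show ?thesis by (simp add: cis_neq_zero)
qed

section \<open>Finitely supported functions on the lattice\<close>

definition lattice_box :: "nat \<Rightarrow> (int ^ 'd) set" where
  "lattice_box r = {m. \<forall>i. \<bar>m $ i\<bar> \<le> int r}"

lemma lattice_box_mono: "r \<le> s \<Longrightarrow> lattice_box r \<subseteq> lattice_box s"
proof
  fix m assume "r \<le> s" "m \<in> lattice_box r"
  then have "\<bar>m $ i\<bar> \<le> int s" for i
    using order_trans[of "\<bar>m $ i\<bar>" "int r" "int s"] by (simp add: lattice_box_def)
  then show "m \<in> lattice_box s" by (simp add: lattice_box_def)
qed

lemma finite_lattice_box: "finite (lattice_box r :: (int ^ 'd) set)"
  and card_lattice_box_le: "card (lattice_box r :: (int ^ 'd) set) \<le> (2 * r + 1) ^ CARD('d)"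
proof -
  let ?P = "PiE UNIV (\<lambda>_ :: 'd. {- int r..int r})"
  have inj: "inj_on vec_nth (lattice_box r :: (int ^ 'd) set)"
    by (simp add: inj_on_def vec_nth_inject)
  have sub: "vec_nth ` (lattice_box r :: (int ^ 'd) set) \<subseteq> ?P"
  proof
    fix f assume "f \<in> vec_nth ` (lattice_box r :: (int ^ 'd) set)"
    then obtain m :: "int ^ 'd" where m: "f = vec_nth m" "\<And>i. \<bar>m $ i\<bar> \<le> int r"
      by (auto simp: lattice_box_def)
    have "m $ i \<in> {- int r..int r}" for i
      using m(2)[of i] by (simp add: abs_le_iff minus_le_iff)
    then show "f \<in> ?P" by (simp add: m(1) PiE_def)
  qed
  have fin: "finite ?P" by (intro finite_PiE) auto
  show "finite (lattice_box r :: (int ^ 'd) set)"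
    by (rule inj_on_finite[OF inj sub fin])
  have "card (lattice_box r :: (int ^ 'd) set) \<le> card ?P"
    by (rule card_inj_on_le[OF inj sub fin])
  also have "card ?P = nat (2 * int r + 1) ^ CARD('d)"
    by (simp add: card_PiE)
  also have "nat (2 * int r + 1) = 2 * r + 1" by simp
  finally show "card (lattice_box r :: (int ^ 'd) set) \<le> (2 * r + 1) ^ CARD('d)" .
qed

text \<open>The radius is kept explicit because the final estimate depends on how fast supports
  grow: by one for each application of the transverse operator.\<close>

definition supp_in :: "nat \<Rightarrow> (int ^ 'd) l2 \<Rightarrow> bool" where
  "supp_in r p \<longleftrightarrow> (\<forall>m. m \<notin> lattice_box r \<longrightarrow> l2_apply p m = 0)"

lemma supp_inI: "(\<And>m i. l2_apply p m \<noteq> 0 \<Longrightarrow> \<bar>m $ i\<bar> \<le> int r) \<Longrightarrow> supp_in r p"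
  unfolding supp_in_def lattice_box_def by blast

lemma supp_inD: "supp_in r p \<Longrightarrow> l2_apply p m \<noteq> 0 \<Longrightarrow> \<bar>m $ i\<bar> \<le> int r"
  unfolding supp_in_def lattice_box_def by blast

lemma supp_in_mono: "supp_in r p \<Longrightarrow> r \<le> s \<Longrightarrow> supp_in s p"
  unfolding supp_in_def using lattice_box_mono by blast

lemma supp_in_zero: "supp_in r 0"
  by (simp add: supp_in_def zero_l2.rep_eq)

lemma supp_in_add: "supp_in r p \<Longrightarrow> supp_in r q \<Longrightarrow> supp_in r (p + q)"
  by (simp add: supp_in_def plus_l2.rep_eq)

lemma supp_in_diff: "supp_in r p \<Longrightarrow> supp_in r q \<Longrightarrow> supp_in r (p - q)"
  by (simp add: supp_in_def l2_apply_diff)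

lemma supp_in_scaleR: "supp_in r p \<Longrightarrow> supp_in r (a *\<^sub>R p)"
  by (simp add: supp_in_def scaleR_l2.rep_eq)

lemma supp_in_sum: "(\<And>j. j \<in> J \<Longrightarrow> supp_in r (p j)) \<Longrightarrow> supp_in r (\<Sum>j\<in>J. p j)"
  by (induction J rule: infinite_finite_induct) (auto intro: supp_in_zero supp_in_add)

lemma supp_in_shift:
  assumes p: "supp_in r p" and h: "\<And>i. \<bar>h $ i\<bar> \<le> 1"
  shows "supp_in (Suc r) (shift h p)"
proof (rule supp_inI)
  fix m i assume "l2_apply (shift h p) m \<noteq> 0"
  then have "\<bar>(m + h) $ i\<bar> \<le> int r"
    by (intro supp_inD[OF p]) (simp add: shift.rep_eq)
  then show "\<bar>m $ i\<bar> \<le> int (Suc r)" using h[of i] by simp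
qed

definition finsupp :: "(int ^ 'd) l2 set" where
  "finsupp = {p. \<exists>r. supp_in r p}"

lemma subspace_finsupp: "subspace finsupp"
proof (rule subspaceI)
  show "0 \<in> finsupp" using supp_in_zero by (auto simp: finsupp_def)
  show "p + q \<in> finsupp" if pq: "p \<in> finsupp" "q \<in> finsupp" for p q :: "(int ^ 'd) l2"
  proof -
    obtain r s where "supp_in r p" "supp_in s q" using pq unfolding finsupp_def by blast
    then have "supp_in (max r s) (p + q)"
      by (meson supp_in_add supp_in_mono max.cobounded1 max.cobounded2)
    then show ?thesis by (auto simp: finsupp_def)
  qed
  show "a *\<^sub>R p \<in> finsupp" if "p \<in> finsupp" for a and p :: "(int ^ 'd) l2"
    using that supp_in_scaleR by (auto simp: finsupp_def)
qed

text \<open>A sum over an infinite set defaults to 0, so this is the Fourier transform on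
  \<open>finsupp\<close> only; hence the hypotheses of the linearity lemmas.\<close>

definition fourier :: "(int ^ 'd) l2 \<Rightarrow> real ^ 'd \<Rightarrow> complex" where
  "fourier p x = (\<Sum>m | l2_apply p m \<noteq> 0. of_real (l2_apply p m) * cis (phase x m))"

lemma fourier_eq_sum:
  assumes "finite A" "\<And>m. l2_apply p m \<noteq> 0 \<Longrightarrow> m \<in> A"
  shows "fourier p x = (\<Sum>m\<in>A. of_real (l2_apply p m) * cis (phase x m))"
  unfolding fourier_def by (rule sum.mono_neutral_left) (use assms in auto)

lemma fourier_eq_sum_box:
  "supp_in r p \<Longrightarrow> fourier p x = (\<Sum>m\<in>lattice_box r. of_real (l2_apply p m) * cis (phase x m))"
  by (rule fourier_eq_sum) (auto simp: finite_lattice_box supp_in_def)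

lemma fourier_add:
  assumes "p \<in> finsupp" "q \<in> finsupp"
  shows "fourier (p + q) x = fourier p x + fourier q x"
proof -
  obtain r s where "supp_in r p" "supp_in s q" using assms unfolding finsupp_def by blast
  then have "supp_in (max r s) p" "supp_in (max r s) q"
    by (meson supp_in_mono max.cobounded1 max.cobounded2)+
  then show ?thesis
    by (simp add: fourier_eq_sum_box[of "max r s"] supp_in_add plus_l2.rep_eq distrib_right
        sum.distrib)
qed

lemma fourier_scaleR:
  assumes "p \<in> finsupp"
  shows "fourier (a *\<^sub>R p) x = of_real a * fourier p x"
proof -
  obtain r where "supp_in r p" using assms by (auto simp: finsupp_def)
  then show ?thesis
    by (simp add: fourier_eq_sum_box[of r] supp_in_scaleR scaleR_l2.rep_eq sum_distrib_left
        mult.assoc)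
qed

lemma fourier_diff:
  assumes "p \<in> finsupp" "q \<in> finsupp"
  shows "fourier (p - q) x = fourier p x - fourier q x"
  using fourier_add[OF assms(1) subspace_scale[OF subspace_finsupp assms(2), of "- 1"], of x]
    fourier_scaleR[OF assms(2), of "- 1" x] by simp

lemma fourier_sum:
  assumes "\<And>j. j \<in> J \<Longrightarrow> p j \<in> finsupp"
  shows "fourier (\<Sum>j\<in>J. p j) x = (\<Sum>j\<in>J. fourier (p j) x)"
  using assms
proof (induction J rule: infinite_finite_induct)
  case (insert j J)
  then show ?case
    using subspace_sum[OF subspace_finsupp, of J p] by (simp add: fourier_add)
qed (simp_all add: fourier_def zero_l2.rep_eq)

lemma fourier_shift: "fourier (shift h p) x = cis (- phase x h) * fourier p x"
proof -
  have "fourier (shift h p) x =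
      (\<Sum>m | l2_apply p m \<noteq> 0. of_real (l2_apply p m) * cis (phase x (m - h)))"
    unfolding fourier_def shift.rep_eq
    by (rule sum.reindex_bij_witness[of _ "\<lambda>m. m - h" "\<lambda>m. m + h"]) auto
  also have "\<dots> = cis (- phase x h) * fourier p x"
    unfolding fourier_def sum_distrib_left
    by (intro sum.cong refl) (simp add: phase_diff_right cis_mult mult.left_commute)
  finally show ?thesis .
qed

text \<open>Triangle inequality and Cauchy-Schwarz on the box. What matters later is that the factor
  is polynomial in \<open>r\<close>.\<close>

lemma norm_fourier_le:
  fixes p :: "(int ^ 'd) l2"
  assumes "supp_in r p"
  shows "cmod (fourier p x) \<le> (2 * real r + 1) ^ CARD('d) * norm p"
proof -
  let ?B = "lattice_box r :: (int ^ 'd) set"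
  have "cmod (fourier p x) \<le> (\<Sum>m\<in>?B. \<bar>l2_apply p m\<bar>)"
    unfolding fourier_eq_sum_box[OF assms] by (rule sum_norm_le) (simp add: norm_mult)
  also have "\<dots> \<le> sqrt (real (card ?B)) * norm p"
    by (rule sum_abs_le_norm_l2[OF finite_lattice_box])
  also have "\<dots> \<le> real (card ?B) * norm p"
  proof (intro mult_right_mono)
    show "sqrt (real (card ?B)) \<le> real (card ?B)"
      by (rule real_le_lsqrt) (auto simp: power2_eq_square simp flip: of_nat_mult)
  qed simp
  also have "\<dots> \<le> real ((2 * r + 1) ^ CARD('d)) * norm p"
    by (intro mult_right_mono of_nat_mono card_lattice_box_le norm_ge_zero)
  finally show ?thesis by (simp add: add.commute)
qed

lemma fourier_zero_imp_zero:
  fixes p :: "(int ^ 'd) l2"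
  assumes p: "p \<in> finsupp" and U: "open U" "x0 \<in> U" and z: "\<And>x. x \<in> U \<Longrightarrow> fourier p x = 0"
  shows "p = 0"
proof -
  obtain r where r: "supp_in r p" using p by (auto simp: finsupp_def)
  have "\<forall>m\<in>lattice_box r. complex_of_real (l2_apply p m) = 0"
    by (rule trigonometric_polynomial_zero_imp_coeffs_zero[OF finite_lattice_box U])
       (use z fourier_eq_sum_box[OF r] in simp)
  then have "l2_apply p m = 0" for m
    using r by (cases "m \<in> lattice_box r") (auto simp: supp_in_def)
  then show ?thesis by (intro l2_eqI) (simp add: zero_l2.rep_eq)
qed

section \<open>The transverse operator\<close>

text \<open>The operator \<open>T\<close> of the overview. It acts on functions on the whole
  lattice, which avoids a separate type of dimension one less, and its shifts leave coordinate
  \<open>j0\<close> unchanged.\<close>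

definition transverse :: "real \<Rightarrow> 'd \<Rightarrow> (int ^ 'd) l2 \<Rightarrow> (int ^ 'd) l2" where
  "transverse c j0 p =
    c *\<^sub>R p - (\<Sum>j\<in>UNIV - {j0}. shift (axis j 1) p + shift (- axis j 1) p)"

lemma linear_transverse: "linear (transverse c j0)"
  unfolding transverse_def[abs_def]
  by (intro linear_compose_sub linear_compose_sum linear_compose_add linear_compose_scale_right
      linear_shift linear_id[unfolded id_def] ballI)

lemma inner_transverse: "inner (transverse c j0 p) q = inner p (transverse c j0 q)"
  by (simp add: transverse_def inner_diff_left inner_diff_right inner_sum_left inner_sum_right
      inner_add_left inner_add_right inner_shift add.commute)

lemma norm_transverse_le:
  fixes p :: "(int ^ 'd) l2"
  shows "norm (transverse c j0 p) \<le> (\<bar>c\<bar> + 2 * real CARD('d)) * norm p"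
proof -
  have "norm (\<Sum>j\<in>UNIV - {j0}. shift (axis j 1) p + shift (- axis j 1) p)
      \<le> (\<Sum>j\<in>UNIV - {j0}. norm p + norm p)"
    by (intro sum_norm_le norm_triangle_le) (simp add: norm_shift)
  also have "\<dots> \<le> (\<Sum>j\<in>(UNIV :: 'd set). norm p + norm p)"
    by (rule sum_mono2) auto
  finally have "norm (\<Sum>j\<in>UNIV - {j0}. shift (axis j 1) p + shift (- axis j 1) p)
      \<le> 2 * real CARD('d) * norm p" by simp
  then show ?thesis
    unfolding transverse_def
    using norm_triangle_ineq4[of "c *\<^sub>R p"
        "\<Sum>j\<in>UNIV - {j0}. shift (axis j 1) p + shift (- axis j 1) p"]
    by (simp add: distrib_right)
qed

lemma supp_in_transverse: "supp_in r p \<Longrightarrow> supp_in (Suc r) (transverse c j0 p)"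
  unfolding transverse_def
  by (intro supp_in_diff supp_in_sum supp_in_add supp_in_shift supp_in_scaleR)
     (auto simp: axis_def elim: supp_in_mono)

lemma transverse_finsupp: "p \<in> finsupp \<Longrightarrow> transverse c j0 p \<in> finsupp"
  unfolding finsupp_def using supp_in_transverse by blast

text \<open>Opposite shifts contribute conjugate phases, which add up to
  \<open>2 * cos (x $ j)\<close>.\<close>

lemma fourier_transverse:
  assumes p: "p \<in> finsupp"
  shows "fourier (transverse c j0 p) x =
    of_real (c - 2 * (\<Sum>j\<in>UNIV - {j0}. cos (x $ j))) * fourier p x"
proof -
  obtain r where r: "supp_in r p" using p by (auto simp: finsupp_def)
  have sh: "shift h p \<in> finsupp" if "\<And>i. \<bar>h $ i\<bar> \<le> 1" for h
    using supp_in_shift[OF r that] by (auto simp: finsupp_def)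
  have sh1: "shift (axis j 1) p \<in> finsupp" "shift (- axis j 1) p \<in> finsupp" for j
    by (rule sh; simp add: axis_def)+
  have neg: "phase x (- axis j 1) = - x $ j" for j
    using phase_diff_right[of x 0 "axis j 1"] by (simp add: phase_axis phase_def[of x 0])
  have cis: "cis (- t) + cis t = of_real (2 * cos t)" for t
    by (simp add: complex_eq_iff)
  have "fourier (shift (axis j 1) p + shift (- axis j 1) p) x = of_real (2 * cos (x $ j)) * fourier p x"
    for j
    by (simp add: fourier_add sh1 fourier_shift phase_axis neg cis flip: distrib_right)
  then have "fourier (\<Sum>j\<in>UNIV - {j0}. shift (axis j 1) p + shift (- axis j 1) p) x
      = of_real (2 * (\<Sum>j\<in>UNIV - {j0}. cos (x $ j))) * fourier p x"
    by (subst fourier_sum)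
       (simp_all add: sh1 subspace_add[OF subspace_finsupp] sum_distrib_left sum_distrib_right)
  moreover have "(\<Sum>j\<in>UNIV - {j0}. shift (axis j 1) p + shift (- axis j 1) p) \<in> finsupp"
    by (intro subspace_sum[OF subspace_finsupp] subspace_add[OF subspace_finsupp] sh1)
  ultimately show ?thesis
    unfolding transverse_def
    by (simp add: fourier_diff fourier_scaleR p subspace_scale[OF subspace_finsupp] left_diff_distrib)
qed

text \<open>The symbol of \<open>D\<^sup>2 - T\<^sup>2\<close> exceeds \<open>D\<^sup>2 - 4\<close> at such an \<open>x\<close>, while its \<open>k\<close>-th power spreads a
  finitely supported function over polynomially many lattice points only.\<close>

lemma fourier_zero_of_power_bound:
  fixes p :: "(int ^ 'd) l2"
  assumes p: "p \<in> finsupp" and D: "D \<ge> 2"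
    and bound: "\<And>k. norm (((\<lambda>y. D\<^sup>2 *\<^sub>R y - transverse c j0 (transverse c j0 y)) ^^ k) p)
      \<le> K * (D\<^sup>2 - 4) ^ k"
    and x: "(c - 2 * (\<Sum>j\<in>UNIV - {j0}. cos (x $ j)))\<^sup>2 < 4"
  shows "fourier p x = 0"
proof (rule ccontr)
  assume nz: "fourier p x \<noteq> 0"
  let ?S = "\<lambda>y. D\<^sup>2 *\<^sub>R y - transverse c j0 (transverse c j0 y)"
  define t where "t = c - 2 * (\<Sum>j\<in>UNIV - {j0}. cos (x $ j))"
  define s where "s = D\<^sup>2 - t\<^sup>2"
  obtain r where r: "supp_in r p" using p by (auto simp: finsupp_def)
  have D4: "D\<^sup>2 \<ge> 4" using power_mono[OF D, of 2] by simp
  have s: "D\<^sup>2 - 4 < s" using x by (simp add: s_def t_def)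
  \<comment> \<open>Each factor \<open>?S\<close> contains two transverse operators, so it enlarges
    the radius by 2.\<close>
  have supp: "supp_in (r + 2 * k) ((?S ^^ k) p)" for k
  proof (induction k)
    case (Suc k)
    then have "supp_in (Suc (Suc (r + 2 * k))) (?S ((?S ^^ k) p))"
      by (intro supp_in_diff supp_in_scaleR supp_in_transverse) (auto elim: supp_in_mono)
    then show ?case by simp
  qed (simp add: r)
  then have fs: "(?S ^^ k) p \<in> finsupp" for k by (auto simp: finsupp_def)
  have fS: "fourier (?S y) x = of_real s * fourier y x" if "y \<in> finsupp" for y
  proof -
    have "fourier (?S y) x = of_real (D\<^sup>2) * fourier y x - of_real t * (of_real t * fourier y x)"
      using that
      by (simp add: fourier_diff fourier_scaleR fourier_transverse transverse_finsupp
          subspace_scale[OF subspace_finsupp] t_def)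
    then show ?thesis by (simp add: s_def algebra_simps power2_eq_square)
  qed
  have fSk: "fourier ((?S ^^ k) p) x = of_real s ^ k * fourier p x" for k
    by (induction k) (simp_all add: fS fs mult.assoc)
  have s0: "s > 0" using s D4 by linarith
  \<comment> \<open>The midpoint of \<open>D\<^sup>2 - 4\<close> and \<open>s\<close> is positive
    even if \<open>D = 2\<close>, so the ratio \<open>q\<close> lies strictly between 0 and 1. The
    decay of \<open>q ^ k\<close> then beats the polynomial factor.\<close>
  define b where "b = (D\<^sup>2 - 4 + s) / 2"
  have b: "0 < b" "b < s" "D\<^sup>2 - 4 \<le> b" using s D4 by (auto simp: b_def)
  define q where "q = b / s"
  have q: "0 < q" "q < 1" using b s0 by (auto simp: q_def)
  have K0: "K \<ge> 0" using order_trans[OF norm_ge_zero bound[of 0]] by simp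
  have le: "cmod (fourier p x) \<le> K * ((2 * (real r + 2 * real k) + 1) ^ CARD('d) * q ^ k)" for k
  proof -
    have "s ^ k * cmod (fourier p x) = cmod (fourier ((?S ^^ k) p) x)"
      using s0 by (simp add: fSk norm_mult norm_power)
    also have "\<dots> \<le> (2 * real (r + 2 * k) + 1) ^ CARD('d) * norm ((?S ^^ k) p)"
      by (rule norm_fourier_le[OF supp])
    also have "norm ((?S ^^ k) p) \<le> K * b ^ k"
      using b D4 K0 by (intro order_trans[OF bound] mult_left_mono power_mono) auto
    finally have "s ^ k * cmod (fourier p x) \<le> (2 * real (r + 2 * k) + 1) ^ CARD('d) * (K * b ^ k)"
      by (simp add: mult_left_mono)
    then have "cmod (fourier p x) \<le> (2 * real (r + 2 * k) + 1) ^ CARD('d) * (K * b ^ k) / s ^ k"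
      using s0 by (simp add: pos_le_divide_eq mult.commute)
    then show ?thesis by (simp add: q_def power_divide mult_ac)
  qed
  have "(\<lambda>k. (2 * (real r + 2 * real k) + 1) ^ CARD('d) * q ^ k) \<longlonglongrightarrow> 0"
    using q by real_asymp
  then have "(\<lambda>k. K * ((2 * (real r + 2 * real k) + 1) ^ CARD('d) * q ^ k)) \<longlonglongrightarrow> K * 0"
    by (intro tendsto_mult tendsto_const)
  then have "cmod (fourier p x) \<le> K * 0"
    by (rule LIMSEQ_le_const) (use le in blast)
  with nz show False by simp
qed

section \<open>Slices\<close>

text \<open>The values at height \<open>k\<close> are moved to the hyperplane
  \<open>m $ j = 0\<close> and extended by zero, so that all slices lie in one space on which one
  operator acts.\<close>

lift_definition slice :: "'d::finite \<Rightarrow> int \<Rightarrow> (int ^ 'd) l2 \<Rightarrow> (int ^ 'd) l2" is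
  "\<lambda>j k x m. if m $ j = 0 then x (m + axis j k) else 0"
proof -
  fix j :: 'd and k :: int and x :: "int ^ 'd \<Rightarrow> real"
  assume "(\<lambda>i. (x i)\<^sup>2) summable_on UNIV"
  then have "(\<lambda>m. (x (m + axis j k))\<^sup>2) summable_on UNIV"
    using summable_on_reindex_bij_betw[OF bij_plus_right, of "\<lambda>i. (x i)\<^sup>2" "axis j k"] by simp
  then show "(\<lambda>m. (if m $ j = 0 then x (m + axis j k) else 0)\<^sup>2) summable_on UNIV"
    by (rule summable_on_comparison_test) auto
qed

lemma norm_slice_power2:
  "(norm (slice j k w))\<^sup>2 = (\<Sum>\<^sub>\<infinity>m\<in>{m. m $ j = k}. (l2_apply w m)\<^sup>2)"
proof -
  have "(norm (slice j k w))\<^sup>2 = (\<Sum>\<^sub>\<infinity>m\<in>{m. m $ j = 0}. (l2_apply w (m + axis j k))\<^sup>2)"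
    unfolding norm_l2_power2 slice.rep_eq by (rule infsum_cong_neutral) auto
  also have "\<dots> = (\<Sum>\<^sub>\<infinity>m\<in>{m. m $ j = k}. (l2_apply w m)\<^sup>2)"
    by (rule infsum_reindex_bij_betw, rule bij_betw_byWitness[where f' = "\<lambda>m. m - axis j k"])
       auto
  finally show ?thesis .
qed

text \<open>The hyperplanes partition the lattice, so the squared norms of the slices are summable.
  Injective \<open>g\<close> covers both directions \<open>int n\<close> and
  \<open>- int n\<close>.\<close>

lemma slice_tendsto_zero:
  assumes "inj (g :: nat \<Rightarrow> int)"
  shows "(\<lambda>n. slice j (g n) w) \<longlonglongrightarrow> 0"
proof -
  let ?A = "\<lambda>k. {m. m $ j = k}"
  have "bij_betw snd (Sigma UNIV ?A) UNIV"
    by (rule bij_betw_byWitness[where f' = "\<lambda>m. (m $ j, m)"]) auto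
  then have "(\<lambda>x. (l2_apply w (snd x))\<^sup>2) summable_on Sigma UNIV ?A"
    using summable_on_reindex_bij_betw[of snd "Sigma UNIV ?A" UNIV "\<lambda>m. (l2_apply w m)\<^sup>2"]
      l2_summable[of w] by simp
  then have "(\<lambda>k. \<Sum>\<^sub>\<infinity>m\<in>?A k. (l2_apply w (snd (k, m)))\<^sup>2) summable_on UNIV"
    by (rule summable_on_SigmaD) (auto intro: summable_on_subset[OF l2_summable])
  then have "(\<lambda>k. (norm (slice j k w))\<^sup>2) summable_on UNIV"
    by (simp add: norm_slice_power2)
  then have "(\<lambda>k. (norm (slice j k w))\<^sup>2) summable_on range g"
    by (rule summable_on_subset) simp
  then have "(\<lambda>n. (norm (slice j (g n) w))\<^sup>2) summable_on UNIV"
    using summable_on_reindex[OF assms, of "\<lambda>k. (norm (slice j k w))\<^sup>2"] by (simp add: o_def)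
  then have "(\<lambda>n. (norm (slice j (g n) w))\<^sup>2) \<longlonglongrightarrow> 0"
    by (intro summable_LIMSEQ_zero summable_on_imp_summable)
  then have "(\<lambda>n. sqrt ((norm (slice j (g n) w))\<^sup>2)) \<longlonglongrightarrow> sqrt 0"
    by (rule tendsto_real_sqrt)
  then show ?thesis by (simp add: tendsto_norm_zero_iff)
qed

lemma slice_supp_in: "supp_in r g \<Longrightarrow> supp_in r (slice j k g)"
proof -
  assume g: "supp_in r g"
  show ?thesis
  proof (rule supp_inI)
    fix m i assume *: "l2_apply (slice j k g) m \<noteq> 0"
    then have m: "m $ j = 0" by (auto simp: slice.rep_eq split: if_splits)
    have "\<bar>(m + axis j k) $ i\<bar> \<le> int r"
      using * m by (intro supp_inD[OF g]) (simp add: slice.rep_eq)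
    then show "\<bar>m $ i\<bar> \<le> int r" using m by (cases "i = j") (auto simp: axis_def)
  qed
qed

lemma slice_outside_support:
  assumes g: "supp_in r g" and k: "\<bar>k\<bar> > int r"
  shows "slice j k g = 0"
proof (rule l2_eqI)
  fix m
  have "l2_apply g (m + axis j k) = 0" if "m $ j = 0"
  proof (rule ccontr)
    assume "l2_apply g (m + axis j k) \<noteq> 0"
    then have "\<bar>(m + axis j k) $ j\<bar> \<le> int r" by (rule supp_inD[OF g])
    then show False using that k by (simp add: axis_def)
  qed
  then show "l2_apply (slice j k g) m = l2_apply 0 m"
    by (simp add: slice.rep_eq zero_l2.rep_eq)
qed

lemma slice_recurrence:
  fixes w g :: "(int ^ 'd) l2"
  assumes eq: "\<And>n. (\<Sum>j\<in>UNIV. l2_apply w (n + axis j 1) + l2_apply w (n - axis j 1))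
      = c * l2_apply w n + l2_apply g n"
  shows "slice j0 (k + 1) w + slice j0 (k - 1) w = transverse c j0 (slice j0 k w) + slice j0 k g"
proof (rule l2_eqI)
  fix m :: "int ^ 'd"
  have ax: "axis j0 (k + 1) = axis j0 k + (axis j0 1 :: int ^ 'd)"
    "axis j0 (k - 1) = axis j0 k - (axis j0 1 :: int ^ 'd)"
    by (simp_all add: axis_def vec_eq_iff)
  show "l2_apply (slice j0 (k + 1) w + slice j0 (k - 1) w) m
      = l2_apply (transverse c j0 (slice j0 k w) + slice j0 k g) m"
  proof (cases "m $ j0 = 0")
    case True
    \<comment> \<open>The lattice point at height \<open>k\<close> that \<open>m\<close> represents;
      the equation is used there, with the term of direction \<open>j0\<close> split off.\<close>
    let ?n = "m + axis j0 k"
    have sh: "l2_apply (shift (axis j 1) (slice j0 k w)) m = l2_apply w (?n + axis j 1)"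
      "l2_apply (shift (- axis j 1) (slice j0 k w)) m = l2_apply w (?n - axis j 1)"
      if "j \<noteq> j0" for j
      using True that by (simp_all add: shift.rep_eq slice.rep_eq axis_def[of j] algebra_simps)
    have "l2_apply (transverse c j0 (slice j0 k w)) m
        = c * l2_apply w ?n - (\<Sum>j\<in>UNIV - {j0}. l2_apply w (?n + axis j 1) + l2_apply w (?n - axis j 1))"
      using True by (simp add: transverse_def l2_apply_simps sh slice.rep_eq)
    moreover have "l2_apply w (?n + axis j0 1) + l2_apply w (?n - axis j0 1)
        + (\<Sum>j\<in>UNIV - {j0}. l2_apply w (?n + axis j 1) + l2_apply w (?n - axis j 1))
        = c * l2_apply w ?n + l2_apply g ?n"
      using eq[of ?n] by (subst (asm) sum.remove[of _ j0]) auto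
    ultimately show ?thesis
      using True by (simp add: plus_l2.rep_eq slice.rep_eq ax add.assoc[symmetric] add_diff_eq)
  next
    \<comment> \<open>Off the hyperplane both sides vanish, because transverse shifts never reach
      it.\<close>
    case False
    then have "l2_apply (shift h (slice j0 k w)) m = 0" if "h $ j0 = 0" for h
      using that by (simp add: shift.rep_eq slice.rep_eq)
    then have "l2_apply (transverse c j0 (slice j0 k w)) m = 0"
      using False by (simp add: transverse_def l2_apply_simps slice.rep_eq axis_def[where x = 1])
    with False show ?thesis by (simp add: plus_l2.rep_eq slice.rep_eq)
  qed
qed

section \<open>Vanishing on a half space, unique continuation and the conclusion\<close>

lemma helmholtz_solution_zero_on_half_space:
  fixes w g :: "(int ^ 'd) l2"
  assumes c: "\<bar>c\<bar> < 2 * real CARD('d)"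
    and eq: "\<And>n. (\<Sum>j\<in>UNIV. l2_apply w (n + axis j 1) + l2_apply w (n - axis j 1))
      = c * l2_apply w n + l2_apply g n"
    and g: "supp_in r g" and n: "n $ j0 \<ge> int r"
  shows "l2_apply w n = 0"
proof -
  let ?d = "real CARD('d)"
  let ?T = "transverse c j0"
  define D where "D = \<bar>c\<bar> + 2 * ?d"
  have d: "?d \<ge> 1" using one_le_card_finite[where 'a = 'd] by simp
  have D: "D \<ge> 2" using d abs_ge_zero[of c] unfolding D_def by linarith
  have "slice j0 (n $ j0) w = 0"
  proof (rule forced_recurrence_eventually_zero[where T = ?T and D = D and R = "int r"
        and f = "\<lambda>k. slice j0 k g" and P = finsupp])
    show "norm (?T p) \<le> D * norm p" for p
      unfolding D_def by (rule norm_transverse_le)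
    show "(\<lambda>k. slice j0 (int k) w) \<longlonglongrightarrow> 0" "(\<lambda>k. slice j0 (- int k) w) \<longlonglongrightarrow> 0"
      by (rule slice_tendsto_zero; simp add: inj_on_def)+
    show "slice j0 k g \<in> finsupp" for k
      using slice_supp_in[OF g] by (auto simp: finsupp_def)
    show "p = 0" if p: "p \<in> finsupp"
      and bound: "\<And>k. norm (((\<lambda>x. D\<^sup>2 *\<^sub>R x - ?T (?T x)) ^^ k) p) \<le> K * (D\<^sup>2 - 4) ^ k" for p K
    proof (rule fourier_zero_imp_zero[OF p])
      let ?t = "\<lambda>x :: real ^ 'd. c - 2 * (\<Sum>j\<in>UNIV - {j0}. cos (x $ j))"
      show "open {x. (?t x)\<^sup>2 < 4}"
        by (intro open_Collect_less continuous_intros)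
      \<comment> \<open>The witness is the diagonal point where \<open>c\<close> equals twice the
        sum of all \<open>?d\<close> cosines. There \<open>?t\<close> is twice the one omitted
        cosine, that is \<open>c / ?d\<close>, which lies strictly between -2 and 2.\<close>
      have "- 1 \<le> c / (2 * ?d)" "c / (2 * ?d) \<le> 1"
        using c d by (simp_all add: field_simps abs_less_iff)
      then have "?t (\<chi> i. arccos (c / (2 * ?d))) = c - 2 * ((?d - 1) * (c / (2 * ?d)))"
        using d by (simp add: cos_arccos card_Diff_singleton of_nat_diff)
      also have "\<dots> = c / ?d" using d by (simp add: field_simps)
      finally have "?t (\<chi> i. arccos (c / (2 * ?d))) = c / ?d" .
      moreover have "\<bar>c / ?d\<bar> < 2" using c d by (simp add: field_simps)
      then have "\<bar>c / ?d\<bar>\<^sup>2 < 2\<^sup>2" by (intro power_strict_mono) auto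
      then have "(c / ?d)\<^sup>2 < 4" unfolding power2_abs by simp
      ultimately show "(\<chi> i. arccos (c / (2 * ?d))) \<in> {x. (?t x)\<^sup>2 < 4}" by simp
      show "fourier p x = 0" if "x \<in> {x. (?t x)\<^sup>2 < 4}" for x
        by (rule fourier_zero_of_power_bound[OF p D bound]) (use that in simp)
    qed
  qed (use D n slice_outside_support[OF g] in
      \<open>auto simp: linear_transverse inner_transverse slice_recurrence[OF eq] subspace_finsupp
        transverse_finsupp\<close>)
  then have "l2_apply (slice j0 (n $ j0) w) (n - axis j0 (n $ j0)) = 0"
    by (simp add: zero_l2.rep_eq)
  then show ?thesis by (simp add: slice.rep_eq)
qed

text \<open>In the equation at \<open>n + axis j0 1\<close> every point other than \<open>n\<close>
  has a larger \<open>j0\<close> coordinate, so the zero set advances by one layer at a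
  time.\<close>

lemma half_space_unique_continuation:
  fixes w :: "int ^ 'd \<Rightarrow> real"
  assumes eq: "\<And>n. (\<Sum>j\<in>UNIV. w (n + axis j 1) + w (n - axis j 1)) = q n * w n"
    and z: "\<And>n. n $ j0 \<ge> r \<Longrightarrow> w n = 0"
  shows "w n = 0"
proof -
  have "\<forall>n. n $ j0 \<ge> r - int k \<longrightarrow> w n = 0" for k
  proof (induction k)
    case (Suc k)
    show ?case
    proof (intro allI impI)
      fix n assume n: "n $ j0 \<ge> r - int (Suc k)"
      let ?m = "n + axis j0 1"
      have m: "w ?m = 0" using Suc n by simp
      have "w (?m + axis j 1) + w (?m - axis j 1) = 0" if "j \<noteq> j0" for j
        using Suc n that by (simp add: axis_def[of j])
      then have "(\<Sum>j\<in>UNIV - {j0}. w (?m + axis j 1) + w (?m - axis j 1)) = 0"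
        by (intro sum.neutral) auto
      moreover have "w (?m + axis j0 1) = 0" using Suc n by simp
      ultimately show "w n = 0"
        using eq[of ?m] m by (subst (asm) sum.remove[of _ j0]) auto
    qed
  qed (use z in simp)
  from this[of "nat (r - n $ j0)"] show ?thesis by simp
qed

text \<open>The potential plays two roles: \<open>4 * V n * w n\<close> is first a finitely
  supported source \<open>g\<close>, which gives a half space of zeros, and then part of the
  coefficient \<open>q\<close> in unique continuation.\<close>

lemma real_eigenfunction_zero:
  fixes V w :: "int ^ 'd \<Rightarrow> real"
  assumes w: "(\<lambda>n. (w n)\<^sup>2) summable_on UNIV"
    and V: "\<And>n i. V n \<noteq> 0 \<Longrightarrow> \<bar>n $ i\<bar> \<le> int r"
    and c: "\<bar>c\<bar> < 2 * real CARD('d)"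
    and eq: "\<And>n. (\<Sum>j\<in>UNIV. w (n + axis j 1) + w (n - axis j 1)) = (c + 4 * V n) * w n"
  shows "w n = 0"
proof -
  define g where "g = Abs_l2 (\<lambda>n. 4 * V n * w n)"
  have "(\<lambda>n. (4 * V n * w n)\<^sup>2) summable_on UNIV"
  proof (rule finite_nonzero_values_imp_summable_on)
    have "{n \<in> UNIV. (4 * V n * w n)\<^sup>2 \<noteq> 0} \<subseteq> lattice_box r"
      using V by (auto simp: lattice_box_def)
    then show "finite {n \<in> UNIV. (4 * V n * w n)\<^sup>2 \<noteq> 0}"
      by (rule finite_subset) (rule finite_lattice_box)
  qed
  then have g: "l2_apply g = (\<lambda>n. 4 * V n * w n)"
    by (simp add: g_def Abs_l2_inverse)
  have supp: "supp_in r g"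
    by (rule supp_inI) (use V g in auto)
  have W: "l2_apply (Abs_l2 w) = w"
    using w by (simp add: Abs_l2_inverse)
  have "w m = 0" if "m $ j0 \<ge> int r" for m j0
    using helmholtz_solution_zero_on_half_space[OF c _ supp that, of "Abs_l2 w"]
    by (simp add: W g eq distrib_right)
  then show ?thesis
    by (rule half_space_unique_continuation[where q = "\<lambda>n. c + 4 * V n" and r = "int r", OF eq])
qed

theorem theorem2p1:
  fixes V :: "int ^ 'd \<Rightarrow> real"
  assumes "CARD('d) \<ge> 2"
    and "\<exists>R0>0. \<forall>n. lattice_norm n > R0 \<longrightarrow> V n = 0"
  shows "point_spectrum (schroedinger V) \<inter> complex_of_real ` {0<..<real CARD('d)} = {}"
proof (rule ccontr)
  assume "point_spectrum (schroedinger V) \<inter> complex_of_real ` {0<..<real CARD('d)} \<noteq> {}"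
  then obtain l u where l: "0 < l" "l < real CARD('d)" and u: "u \<in> ell2" "u \<noteq> (\<lambda>n. 0)"
    and eig: "schroedinger V u = (\<lambda>n. complex_of_real l * u n)"
    by (auto simp: point_spectrum_def)
  obtain R0 where R0: "\<And>n. lattice_norm n > R0 \<Longrightarrow> V n = 0"
    using assms(2) by blast
  \<comment> \<open>Each coordinate is at most the Euclidean norm, so the ball of radius
    \<open>R0\<close> lies in this box.\<close>
  define r where "r = nat \<lceil>R0\<rceil>"
  have V: "\<bar>n $ i\<bar> \<le> int r" if "V n \<noteq> 0" for n i
  proof -
    have "\<bar>real_of_int (n $ i)\<bar> \<le> lattice_norm n"
      unfolding lattice_norm_def by (rule real_le_rsqrt)
        (use member_le_sum[of i UNIV "\<lambda>i. (real_of_int (n $ i))\<^sup>2"] in simp)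
    also have "\<dots> \<le> R0" using R0[of n] that by force
    also have "\<dots> \<le> real r" unfolding r_def by (rule real_nat_ceiling_ge)
    finally show ?thesis by linarith
  qed
  \<comment> \<open>Four times the eigenvalue equation, solved for the neighbour sum, has this
    constant; \<open>0 < l < d\<close> says exactly that
    \<open>\<bar>c\<bar> < 2 * d\<close>.\<close>
  define c where "c = 2 * real CARD('d) - 4 * l"
  have c: "\<bar>c\<bar> < 2 * real CARD('d)" using l by (simp add: c_def abs_less_iff)
  have eq: "(\<Sum>j\<in>UNIV. u (n + axis j 1) + u (n - axis j 1)) = complex_of_real (c + 4 * V n) * u n"
    for n
    using fun_cong[OF eig, of n]
    by (simp add: schroedinger_def discrete_laplacian_def multiplication_operator_def c_def
        field_simps)
  have sq: "(\<lambda>n. (cmod (u n))\<^sup>2) summable_on UNIV" using u(1) by (simp add: ell2_def)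
  \<comment> \<open>The coefficients \<open>c + 4 * V n\<close> are real, so real and imaginary
    parts solve the same equation.\<close>
  have "Re (u n) = 0" for n
  proof (rule real_eigenfunction_zero[OF _ V c])
    show "(\<lambda>n. (Re (u n))\<^sup>2) summable_on UNIV"
      by (rule summable_on_comparison_test[OF sq]) (auto simp: cmod_power2)
    show "(\<Sum>j\<in>UNIV. Re (u (n + axis j 1)) + Re (u (n - axis j 1))) = (c + 4 * V n) * Re (u n)"
      for n
      using arg_cong[OF eq[of n], of Re] by simp
  qed
  moreover have "Im (u n) = 0" for n
  proof (rule real_eigenfunction_zero[OF _ V c])
    show "(\<lambda>n. (Im (u n))\<^sup>2) summable_on UNIV"
      by (rule summable_on_comparison_test[OF sq]) (auto simp: cmod_power2)
    show "(\<Sum>j\<in>UNIV. Im (u (n + axis j 1)) + Im (u (n - axis j 1))) = (c + 4 * V n) * Im (u n)"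
      for n
      using arg_cong[OF eq[of n], of Im] by simp
  qed
  ultimately have "u = (\<lambda>n. 0)" by (auto simp: complex_eq_iff)
  with u(2) show False by contradiction
qed

end
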